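(* Let $\mu$ be a compactly supported Borel probability measure on $\mathbb{R}$ whose support is disconnected. For $\delta>0$ let $\gamma_\delta$ be the Gaussian measure on $\mathbb{R}$ with mean $0$ and variance $\delta$, and let $c(\delta)$ be the log Sobolev constant for $\mu*\gamma_\delta$. Then there exists $C>0$ such that $c(\delta)\geq\exp\left(C/\delta\right)$ for all sufficiently small $\delta>0$.
   Context: A probability measure $\nu$ on $\mathbb{R}$ satisfies a logarithmic Sobolev inequality (LSI) with constant $c\in\mathbb{R}$ if $\mathrm{Ent}_\nu(g^2)\leq 2c\int|g'|^2\,d\nu$ for all smooth and sufficiently integrable functions $g:\mathbb{R}\to\mathbb{R}$ (meaning: $g$ is $C^\infty$ and $g^2$, $g^2\log g^2$ and $|g'|^2$ are $\nu$-integrable), where for measurable $f\geq 0$, $\mathrm{Ent}_\nu(f)=\int f\log f\,d\nu-\int f\,d\nu\,\log\int f\,d\nu$, with the convention $0\log 0=0$. The log Sobolev constant for $\nu$ is the smallest $c$ for which the LSI holds. *)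

theory Defs
  imports "HOL-Probability.Probability"
begin

definition measure_support :: "real measure \<Rightarrow> real set" where
  "measure_support \<nu> = {x. \<forall>U. open U \<longrightarrow> x \<in> U \<longrightarrow> 0 < emeasure \<nu> U}"

definition smooth :: "(real \<Rightarrow> real) \<Rightarrow> bool" where
  "smooth g \<longleftrightarrow> (\<forall>k x. (deriv ^^ k) g differentiable (at x))"

text \<open>The library has \<open>ln 0 = 0\<close>, so the convention \<open>0 log 0 = 0\<close> holds automatically.\<close>

definition Ent :: "real measure \<Rightarrow> (real \<Rightarrow> real) \<Rightarrow> real" where
  "Ent \<nu> f = (\<integral>x. f x * ln (f x) \<partial>\<nu>) - (\<integral>x. f x \<partial>\<nu>) * ln (\<integral>x. f x \<partial>\<nu>)"

definition LSI :: "real measure \<Rightarrow> real \<Rightarrow> bool" where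
  "LSI \<nu> c \<longleftrightarrow>
    (\<forall>g. smooth g \<longrightarrow>
         integrable \<nu> (\<lambda>x. (g x)\<^sup>2) \<longrightarrow>
         integrable \<nu> (\<lambda>x. (g x)\<^sup>2 * ln ((g x)\<^sup>2)) \<longrightarrow>
         integrable \<nu> (\<lambda>x. \<bar>deriv g x\<bar>\<^sup>2) \<longrightarrow>
         Ent \<nu> (\<lambda>x. (g x)\<^sup>2) \<le> 2 * c * (\<integral>x. \<bar>deriv g x\<bar>\<^sup>2 \<partial>\<nu>))"

text \<open>
  The log Sobolev constant is extended-real-valued, being \<open>\<infinity>\<close> if no LSI holds. Otherwise
  the infimum is attained: by \<open>log_sobolev_constant_eq_iff\<close> below, a real value of it is
  the smallest admissible constant.
\<close>

definition log_sobolev_constant :: "real measure \<Rightarrow> ereal" where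
  "log_sobolev_constant \<nu> = Inf {ereal c | c. LSI \<nu> c}"

lemma log_sobolev_constant_eq_iff:
  "log_sobolev_constant \<nu> = ereal c \<longleftrightarrow> LSI \<nu> c \<and> (\<forall>c'. LSI \<nu> c' \<longrightarrow> c \<le> c')"
proof
  assume *: "log_sobolev_constant \<nu> = ereal c"
  have lower: "c \<le> c'" if "LSI \<nu> c'" for c'
  proof -
    have "log_sobolev_constant \<nu> \<le> ereal c'"
      unfolding log_sobolev_constant_def using that by (intro Inf_lower) auto
    then show ?thesis using * by simp
  qed
  have approx: "\<exists>c'. LSI \<nu> c' \<and> c' < b" if "c < b" for b
  proof -
    have "Inf {ereal c | c. LSI \<nu> c} < ereal b"
      using * that by (simp add: log_sobolev_constant_def)
    then show ?thesis unfolding Inf_less_iff by auto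
  qed
  have "LSI \<nu> c"
    unfolding LSI_def
  proof (intro allI impI)
    fix g
    assume g: "smooth g" "integrable \<nu> (\<lambda>x. (g x)\<^sup>2)"
      "integrable \<nu> (\<lambda>x. (g x)\<^sup>2 * ln ((g x)\<^sup>2))" "integrable \<nu> (\<lambda>x. \<bar>deriv g x\<bar>\<^sup>2)"
    define I where "I = (\<integral>x. \<bar>deriv g x\<bar>\<^sup>2 \<partial>\<nu>)"
    have "0 \<le> I" unfolding I_def by simp
    have le: "Ent \<nu> (\<lambda>x. (g x)\<^sup>2) \<le> 2 * b * I" if b: "c < b" for b
    proof -
      obtain c' where c': "LSI \<nu> c'" "c' < b" using approx[OF b] by blast
      have "Ent \<nu> (\<lambda>x. (g x)\<^sup>2) \<le> 2 * c' * I"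
        using c'(1) g unfolding LSI_def I_def by blast
      also have "\<dots> \<le> 2 * b * I"
        using c'(2) \<open>0 \<le> I\<close> by (intro mult_right_mono) auto
      finally show ?thesis .
    qed
    have "((\<lambda>b. 2 * b * I) \<longlongrightarrow> 2 * c * I) (at_right c)"
      by (intro tendsto_intros)
    moreover have "\<forall>\<^sub>F b in at_right c. Ent \<nu> (\<lambda>x. (g x)\<^sup>2) \<le> 2 * b * I"
      using le by (auto simp: eventually_at_filter)
    ultimately show "Ent \<nu> (\<lambda>x. (g x)\<^sup>2) \<le> 2 * c * (\<integral>x. \<bar>deriv g x\<bar>\<^sup>2 \<partial>\<nu>)"
      unfolding I_def by (rule tendsto_lowerbound) simp
  qed
  with lower show "LSI \<nu> c \<and> (\<forall>c'. LSI \<nu> c' \<longrightarrow> c \<le> c')" by blast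
next
  assume "LSI \<nu> c \<and> (\<forall>c'. LSI \<nu> c' \<longrightarrow> c \<le> c')"
  then show "log_sobolev_constant \<nu> = ereal c"
    unfolding log_sobolev_constant_def by (intro Inf_eqI) auto
qed

text \<open>\<^const>\<open>normal_density\<close> takes the standard deviation, hence the square root of the variance.\<close>

definition gaussian :: "real \<Rightarrow> real measure" where
  "gaussian \<delta> = density lborel (normal_density 0 (sqrt \<delta>))"

end

theory Submission
  imports Defs "HOL-Real_Asymp.Real_Asymp"
begin

text \<open>
  A log Sobolev inequality bounds the entropy of a test function by its energy
  \<open>\<integral> \<bar>g'\<bar>\<^sup>2\<close>, so a measure with two lumps of mass separated by a nearly empty gap has a large
  constant: a \<open>g\<close> that climbs from \<open>0\<close> to \<open>1\<close> inside the gap costs almost nothing, while its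
  entropy stays of the order of the product of the two masses.

  Since the support of \<open>\<mu>\<close> is disconnected, some interval of radius \<open>r\<close> around a point \<open>z\<close> is
  \<open>\<mu>\<close>-null and has \<open>\<mu>\<close>-mass \<open>p > 0\<close> on its left and \<open>q > 0\<close> on its right
  (\<open>disconnected_support_gap\<close>). After convolution with the Gaussian of variance \<open>\<delta>\<close>, mass gets
  within \<open>r/2\<close> of \<open>z\<close> only if the Gaussian part moves it by at least \<open>r/2\<close>, which has probability
  at most \<open>\<surd>2 exp (- r\<^sup>2 / (16 \<delta>))\<close> (\<open>gaussian_tail\<close>), and each side retains at least
  half of its mass.

  The test function is the logistic function \<open>s\<close> with slope parameter \<open>1/\<delta>\<close>, centred at
  \<open>z\<close>. It satisfies \<open>s' = s (1 - s) / \<delta>\<close>, which makes it smooth and lets the single number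
  \<open>w = \<integral> s (1 - s)\<close> control both sides of the inequality: the energy is at most
  \<open>w / \<delta>\<^sup>2\<close>, and \<open>\<integral> s\<^sup>2 ln s\<^sup>2 \<ge> - 2 w\<close>. As \<open>s (1 - s)\<close> is exponentially small in
  \<open>1/\<delta>\<close> off the gap and the gap has exponentially small mass, \<open>w\<close> is \<open>O (exp (- K / \<delta>))\<close>
  with \<open>K = min (r/2) (r\<^sup>2/16)\<close>. The two estimates of
  \<open>LSI_two_lumps\<close> combine to \<open>const p q \<le> w (1 + c / \<delta>\<^sup>2)\<close>, and any exponent below \<open>K\<close>
  absorbs the polynomial factors in \<open>\<delta>\<close>.
\<close>

section \<open>The logistic test function\<close>

definition logistic :: "real \<Rightarrow> real \<Rightarrow> real \<Rightarrow> real" where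
  "logistic l z x = 1 / (1 + exp (- (l * (x - z))))"

lemma logistic_pos: "0 < logistic l z x"
  and logistic_less_1: "logistic l z x < 1"
  by (simp_all add: logistic_def add_pos_pos)

lemma one_minus_logistic: "1 - logistic l z x = 1 / (1 + exp (l * (x - z)))"
proof -
  have "0 < 1 + exp (l * (x - z))" by (simp add: add_pos_pos)
  then show ?thesis unfolding logistic_def exp_minus by (simp add: divide_simps)
qed

lemma logistic_ge_half: "0 \<le> l \<Longrightarrow> z \<le> x \<Longrightarrow> 1 / 2 \<le> logistic l z x"
  unfolding logistic_def by (intro divide_left_mono) (auto simp: add_pos_pos)

lemma logistic_le_half: "0 \<le> l \<Longrightarrow> x \<le> z \<Longrightarrow> logistic l z x \<le> 1 / 2"
  unfolding logistic_def
  by (intro divide_left_mono) (auto simp: add_pos_pos mult_nonneg_nonpos)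

lemma logistic_variance_le_exp:
  "logistic l z x * (1 - logistic l z x) \<le> exp (- (l * \<bar>x - z\<bar>))"
proof (cases "z \<le> x")
  case True
  have "logistic l z x * (1 - logistic l z x) \<le> 1 - logistic l z x"
    using logistic_pos[of l z x] logistic_less_1[of l z x] by (intro mult_left_le_one_le) auto
  also have "\<dots> \<le> 1 / exp (l * (x - z))"
    unfolding one_minus_logistic by (intro divide_left_mono) (auto simp: add_pos_pos)
  finally show ?thesis using True by (simp add: exp_minus inverse_eq_divide)
next
  case False
  have "logistic l z x * (1 - logistic l z x) \<le> logistic l z x"
    using logistic_pos[of l z x] logistic_less_1[of l z x] by (intro mult_right_le_one_le) auto
  also have "\<dots> \<le> 1 / exp (- (l * (x - z)))"
    unfolding logistic_def by (intro divide_left_mono) (auto simp: add_pos_pos)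
  also have "1 / exp (- (l * (x - z))) = exp (- (l * \<bar>x - z\<bar>))"
    using False
    by (simp add: exp_minus[symmetric] inverse_eq_divide[symmetric] right_diff_distrib)
  finally show ?thesis .
qed

lemma DERIV_logistic:
  "(logistic l z has_real_derivative l * (logistic l z x * (1 - logistic l z x))) (at x)"
proof -
  have "1 + exp (- (l * (x - z))) \<noteq> 0"
    by (metis add_pos_pos exp_gt_zero less_irrefl zero_less_one)
  then show ?thesis
    unfolding logistic_def
    by (auto intro!: derivative_eq_intros simp: field_simps power2_eq_square)
qed

lemma deriv_logistic: "deriv (logistic l z) x = l * (logistic l z x * (1 - logistic l z x))"
  by (rule DERIV_imp_deriv[OF DERIV_logistic])

text \<open>
  The differential equation of the logistic function turns a polynomial in it into another such
  polynomial under differentiation, so all derivatives are of this form.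
\<close>

lemma smooth_logistic: "smooth (logistic l z)"
proof -
  have D: "((\<lambda>x. poly P (logistic l z x)) has_real_derivative
      poly (smult l (pderiv P * [:0, 1, -1:])) (logistic l z x)) (at x)" for P x
    by (rule DERIV_cong[OF DERIV_chain2[OF poly_DERIV DERIV_logistic]]) (simp add: algebra_simps)
  have "\<exists>P. (deriv ^^ k) (logistic l z) = (\<lambda>x. poly P (logistic l z x))" for k
  proof (induction k)
    case 0
    show ?case by (rule exI[of _ "[:0, 1:]"]) auto
  next
    case (Suc k)
    then obtain P where "(deriv ^^ k) (logistic l z) = (\<lambda>x. poly P (logistic l z x))" by blast
    then have "(deriv ^^ Suc k) (logistic l z)
        = (\<lambda>x. poly (smult l (pderiv P * [:0, 1, -1:])) (logistic l z x))"
      using ext[OF DERIV_imp_deriv[OF D]] by (simp only: funpow.simps comp_apply)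
    then show ?case ..
  qed
  then show ?thesis unfolding smooth_def by (metis D real_differentiable_def)
qed

lemma borel_measurable_logistic [measurable]: "logistic l z \<in> borel_measurable borel"
  unfolding logistic_def by measurable

section \<open>The log Sobolev constant of a measure with a thin gap\<close>

lemma square_times_ln_square_bounds:
  fixes s :: real
  assumes "0 < s" "s < 1"
  shows "- 2 * (s * (1 - s)) \<le> s\<^sup>2 * ln (s\<^sup>2)" "s\<^sup>2 * ln (s\<^sup>2) \<le> 0"
proof -
  have ln: "ln (s\<^sup>2) = 2 * ln s"
    using assms by (simp add: ln_realpow)
  have "1 - 1 / s \<le> ln s"
    using ln_le_minus_one[of "1 / s"] assms by (simp add: ln_div)
  then have "s\<^sup>2 * (1 - 1 / s) \<le> s\<^sup>2 * ln s"
    by (intro mult_left_mono) auto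
  moreover have "s\<^sup>2 * (1 - 1 / s) = - (s * (1 - s))"
    using assms by (simp add: field_simps power2_eq_square)
  ultimately show "- 2 * (s * (1 - s)) \<le> s\<^sup>2 * ln (s\<^sup>2)"
    unfolding ln by (simp only: mult.left_commute[of _ 2] minus_mult_left[symmetric])
  show "s\<^sup>2 * ln (s\<^sup>2) \<le> 0"
    unfolding ln using assms by (simp add: mult_nonneg_nonpos)
qed

text \<open>
  The first estimate is the log Sobolev inequality for the logistic function. With \<open>m = \<integral> s\<^sup>2\<close>,
  the entropy contains \<open>- m ln m \<ge> m (1 - m)\<close>, where \<open>m \<ge> q / 4\<close> because \<open>s \<ge> 1/2\<close> on the
  right of \<open>z\<close> and \<open>1 - m \<ge> 3 p / 4\<close> because \<open>s \<le> 1/2\<close> on the left. The quantity \<open>w\<close>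
  bounds \<open>\<integral> s (1 - s)\<close>: the first summand is a pointwise bound off the gap, the second the
  mass of the gap.
\<close>

lemma LSI_two_lumps:
  fixes \<nu> :: "real measure"
  assumes "prob_space \<nu>" and sets [measurable_cong]: "sets \<nu> = sets borel"
    and LSI: "LSI \<nu> c" and "0 < l" "0 \<le> a"
    and gap: "measure \<nu> {x. \<bar>x - z\<bar> < a} \<le> \<tau>"
    and left: "p \<le> measure \<nu> {..z}" and right: "q \<le> measure \<nu> {z..}"
    and "0 \<le> p" "0 \<le> q"
  defines "w \<equiv> exp (- (l * a)) + \<tau>"
  shows "3 / 16 * (p * q) - 2 * w \<le> 2 * c * (\<integral>x. \<bar>deriv (logistic l z) x\<bar>\<^sup>2 \<partial>\<nu>)"
    and "(\<integral>x. \<bar>deriv (logistic l z) x\<bar>\<^sup>2 \<partial>\<nu>) \<le> l\<^sup>2 * w"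
proof -
  interpret prob_space \<nu> by fact
  have space: "space \<nu> = UNIV"
    using sets_eq_imp_space_eq[OF sets] by simp
  define s where "s = logistic l z"
  have s: "0 < s x" "s x < 1" for x
    by (simp_all add: s_def logistic_pos logistic_less_1)
  have [measurable]: "s \<in> borel_measurable borel"
    by (simp add: s_def)
  have V: "0 \<le> s x * (1 - s x)" "s x * (1 - s x) \<le> 1" for x
    using s[of x] by (auto intro: mult_le_one)
  have sq: "(s x)\<^sup>2 \<le> 1" for x
    using s[of x] by (simp add: power_le_one)
  have energy_density: "\<bar>deriv s x\<bar>\<^sup>2 = l\<^sup>2 * (s x * (1 - s x))\<^sup>2" for x
    by (simp add: s_def deriv_logistic power_mult_distrib)
  have V2: "(s x * (1 - s x))\<^sup>2 \<le> s x * (1 - s x)" for x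
    using V[of x] by (simp add: power2_eq_square mult_left_le)
  have bounds: "- 2 * (s x * (1 - s x)) \<le> (s x)\<^sup>2 * ln ((s x)\<^sup>2)" "(s x)\<^sup>2 * ln ((s x)\<^sup>2) \<le> 0" for x
    using square_times_ln_square_bounds[OF s] by auto
  have int_V: "integrable \<nu> (\<lambda>x. s x * (1 - s x))"
    by (rule integrable_const_bound[of _ 1]) (use V in \<open>auto simp: abs_of_nonneg simp del: abs_mult\<close>)
  have int_V2: "integrable \<nu> (\<lambda>x. (s x * (1 - s x))\<^sup>2)"
    by (rule integrable_const_bound[of _ 1])
      (use order_trans[OF V2 V(2)] in \<open>auto simp: abs_of_nonneg\<close>)
  have int_sq: "integrable \<nu> (\<lambda>x. (s x)\<^sup>2)"
    by (rule integrable_const_bound[of _ 1]) (use sq in auto)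
  have int_ln: "integrable \<nu> (\<lambda>x. (s x)\<^sup>2 * ln ((s x)\<^sup>2))"
  proof (rule integrable_const_bound[of _ 2])
    have "\<bar>(s x)\<^sup>2 * ln ((s x)\<^sup>2)\<bar> \<le> 2" for x
      using bounds[of x] V[of x] by linarith
    then show "AE x in \<nu>. norm ((s x)\<^sup>2 * ln ((s x)\<^sup>2)) \<le> 2" by simp
  qed measurable
  have int_energy: "integrable \<nu> (\<lambda>x. \<bar>deriv s x\<bar>\<^sup>2)"
    unfolding energy_density using int_V2 by simp

  have meas_gap [measurable]: "{x. \<bar>x - z\<bar> < a} \<in> sets borel" by measurable
  have "(\<integral>x. s x * (1 - s x) \<partial>\<nu>) \<le> (\<integral>x. exp (- (l * a)) + indicator {x. \<bar>x - z\<bar> < a} x \<partial>\<nu>)"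
  proof (rule integral_mono[OF int_V])
    show "integrable \<nu> (\<lambda>x. exp (- (l * a)) + indicator {x. \<bar>x - z\<bar> < a} x :: real)"
      by (intro Bochner_Integration.integrable_add integrable_real_indicator)
        (auto simp: sets emeasure_eq_measure)
    fix x
    show "s x * (1 - s x) \<le> exp (- (l * a)) + indicator {x. \<bar>x - z\<bar> < a} x"
    proof (cases "\<bar>x - z\<bar> < a")
      case True
      then show ?thesis using V(2)[of x] by (simp add: add_increasing)
    next
      case False
      have "s x * (1 - s x) \<le> exp (- (l * \<bar>x - z\<bar>))"
        unfolding s_def by (rule logistic_variance_le_exp)
      also have "\<dots> \<le> exp (- (l * a))"
        using False \<open>0 < l\<close> by simp
      finally show ?thesis using False by simp
    qed
  qed
  also have "\<dots> = exp (- (l * a)) + measure \<nu> {x. \<bar>x - z\<bar> < a}"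
    using meas_gap by (subst Bochner_Integration.integral_add)
      (use prob_space in \<open>auto simp: sets emeasure_eq_measure space\<close>)
  finally have V_le: "(\<integral>x. s x * (1 - s x) \<partial>\<nu>) \<le> w"
    using gap unfolding w_def by linarith

  have "(\<integral>x. \<bar>deriv s x\<bar>\<^sup>2 \<partial>\<nu>) = l\<^sup>2 * (\<integral>x. (s x * (1 - s x))\<^sup>2 \<partial>\<nu>)"
    unfolding energy_density by simp
  also have "\<dots> \<le> l\<^sup>2 * w"
    by (intro mult_left_mono order_trans[OF integral_mono[OF int_V2 int_V] V_le] V2) auto
  finally show "(\<integral>x. \<bar>deriv (logistic l z) x\<bar>\<^sup>2 \<partial>\<nu>) \<le> l\<^sup>2 * w"
    unfolding s_def .

  define m where "m = (\<integral>x. (s x)\<^sup>2 \<partial>\<nu>)"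
  have "q / 4 \<le> (\<integral>x. 1 / 4 * indicator {z..} x \<partial>\<nu>)"
    using right by simp
  also have "\<dots> \<le> m"
    unfolding m_def
  proof (rule integral_mono[OF _ int_sq])
    show "integrable \<nu> (\<lambda>x. 1 / 4 * indicator {z..} x :: real)"
      by (intro integrable_mult_right integrable_real_indicator) (auto simp: emeasure_eq_measure sets)
    fix x
    have "z \<le> x \<Longrightarrow> (1 / 2)\<^sup>2 \<le> (s x)\<^sup>2"
      using logistic_ge_half[of l z x] \<open>0 < l\<close> by (intro power_mono) (auto simp: s_def)
    then show "1 / 4 * indicator {z..} x \<le> (s x)\<^sup>2"
      by (auto simp: indicator_def power2_eq_square)
  qed
  finally have m_ge: "q / 4 \<le> m" .
  have "3 / 4 * p \<le> (\<integral>x. 3 / 4 * indicator {..z} x \<partial>\<nu>)"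
    using left by simp
  also have "\<dots> \<le> (\<integral>x. 1 - (s x)\<^sup>2 \<partial>\<nu>)"
  proof (rule integral_mono)
    show "integrable \<nu> (\<lambda>x. 3 / 4 * indicator {..z} x :: real)"
      by (intro integrable_mult_right integrable_real_indicator) (auto simp: emeasure_eq_measure sets)
    show "integrable \<nu> (\<lambda>x. 1 - (s x)\<^sup>2)"
      using int_sq by simp
    fix x
    have "x \<le> z \<Longrightarrow> (s x)\<^sup>2 \<le> (1 / 2)\<^sup>2"
      using logistic_le_half[of l x z] \<open>0 < l\<close> s(1)[of x] by (intro power_mono) (auto simp: s_def)
    then show "3 / 4 * indicator {..z} x \<le> 1 - (s x)\<^sup>2"
      using sq[of x] by (auto simp: indicator_def power2_eq_square)
  qed
  also have "\<dots> = 1 - m"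
    unfolding m_def using int_sq by (simp add: prob_space)
  finally have m_le: "3 / 4 * p \<le> 1 - m" .
  have "(3 / 4 * p) * (q / 4) \<le> (1 - m) * m"
    using m_le m_ge \<open>0 \<le> p\<close> \<open>0 \<le> q\<close> by (intro mult_mono) auto
  also have "\<dots> \<le> - (m * ln m)"
  proof (cases "m = 0")
    case False
    then have "0 < m" using m_ge \<open>0 \<le> q\<close> by linarith
    then have "m * ln m \<le> m * (m - 1)"
      by (intro mult_left_mono ln_le_minus_one) auto
    then show ?thesis by (simp add: algebra_simps)
  qed simp
  finally have mean_part: "3 / 16 * (p * q) \<le> - (m * ln m)" by simp
  have "- 2 * w \<le> (\<integral>x. - 2 * (s x * (1 - s x)) \<partial>\<nu>)"
    using V_le by simp
  also have "\<dots> \<le> (\<integral>x. (s x)\<^sup>2 * ln ((s x)\<^sup>2) \<partial>\<nu>)"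
    using int_V int_ln bounds(1) by (intro integral_mono) auto
  finally have "3 / 16 * (p * q) - 2 * w \<le> Ent \<nu> (\<lambda>x. (s x)\<^sup>2)"
    using mean_part unfolding Ent_def m_def by linarith
  also have "\<dots> \<le> 2 * c * (\<integral>x. \<bar>deriv s x\<bar>\<^sup>2 \<partial>\<nu>)"
    using LSI int_sq int_ln int_energy smooth_logistic[of l z] unfolding LSI_def s_def by blast
  finally show "3 / 16 * (p * q) - 2 * w \<le> 2 * c * (\<integral>x. \<bar>deriv (logistic l z) x\<bar>\<^sup>2 \<partial>\<nu>)"
    unfolding s_def .
qed

section \<open>Gaussian smoothing of a measure with a gap\<close>

lemma prob_space_gaussian: "0 < \<delta> \<Longrightarrow> prob_space (gaussian \<delta>)"
  unfolding gaussian_def by (intro prob_space_normal_density) simp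

lemma sets_gaussian [measurable_cong]: "sets (gaussian \<delta>) = sets borel"
  by (simp add: gaussian_def)

text \<open>
  On \<open>\<bar>y\<bar> \<ge> a\<close> the density is dominated by \<open>\<surd>2 exp (- a\<^sup>2 / (4 \<delta>))\<close> times the density
  of the Gaussian with variance \<open>2 \<delta>\<close>: half of the exponent is spent on the bound, the other half
  on integrability.
\<close>

lemma gaussian_tail:
  assumes "0 < \<delta>" "0 \<le> a"
  shows "measure (gaussian \<delta>) {y. a \<le> \<bar>y\<bar>} \<le> sqrt 2 * exp (- a\<^sup>2 / (4 * \<delta>))"
proof -
  interpret G: prob_space "gaussian \<delta>" by (rule prob_space_gaussian) fact
  define K where "K = sqrt 2 * exp (- a\<^sup>2 / (4 * \<delta>))"
  have K: "0 \<le> K" by (simp add: K_def)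
  have dens: "normal_density 0 (sqrt \<delta>) y \<le> K * normal_density 0 (sqrt (2 * \<delta>)) y"
    if "a \<le> \<bar>y\<bar>" for y
  proof -
    have "a\<^sup>2 \<le> y\<^sup>2"
      using that \<open>0 \<le> a\<close> by (metis abs_of_nonneg abs_le_square_iff)
    then have "- y\<^sup>2 / (2 * \<delta>) \<le> - a\<^sup>2 / (4 * \<delta>) + - y\<^sup>2 / (4 * \<delta>)"
      using \<open>0 < \<delta>\<close> by (simp add: field_simps)
    then have "exp (- y\<^sup>2 / (2 * \<delta>)) \<le> exp (- a\<^sup>2 / (4 * \<delta>)) * exp (- y\<^sup>2 / (4 * \<delta>))"
      unfolding exp_add[symmetric] by simp
    then have "1 / sqrt (2 * pi * \<delta>) * exp (- y\<^sup>2 / (2 * \<delta>))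
        \<le> 1 / sqrt (2 * pi * \<delta>) * (exp (- a\<^sup>2 / (4 * \<delta>)) * exp (- y\<^sup>2 / (4 * \<delta>)))"
      using \<open>0 < \<delta>\<close> by (intro mult_left_mono) auto
    moreover have "1 / sqrt (2 * pi * \<delta>) = sqrt 2 * (1 / sqrt (2 * pi * (2 * \<delta>)))"
      using \<open>0 < \<delta>\<close> by (simp add: real_sqrt_mult field_simps)
    moreover have "normal_density 0 (sqrt \<delta>) y = 1 / sqrt (2 * pi * \<delta>) * exp (- y\<^sup>2 / (2 * \<delta>))"
      "normal_density 0 (sqrt (2 * \<delta>)) y
        = 1 / sqrt (2 * pi * (2 * \<delta>)) * exp (- y\<^sup>2 / (4 * \<delta>))"
      using \<open>0 < \<delta>\<close> by (simp_all add: normal_density_def)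
    ultimately show ?thesis
      unfolding K_def by (simp only: mult_ac)
  qed
  have "emeasure (gaussian \<delta>) {y. a \<le> \<bar>y\<bar>}
      = (\<integral>\<^sup>+y. ennreal (normal_density 0 (sqrt \<delta>) y) * indicator {y. a \<le> \<bar>y\<bar>} y \<partial>lborel)"
    unfolding gaussian_def by (rule emeasure_density) auto
  also have "\<dots> \<le> (\<integral>\<^sup>+y. ennreal K * ennreal (normal_density 0 (sqrt (2 * \<delta>)) y) \<partial>lborel)"
    using K dens
    by (intro nn_integral_mono) (auto simp: indicator_def ennreal_mult[symmetric] intro!: ennreal_leI)
  also have "\<dots> = ennreal K * (\<integral>\<^sup>+y. ennreal (normal_density 0 (sqrt (2 * \<delta>)) y) \<partial>lborel)"
    by (rule nn_integral_cmult) auto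
  also have "(\<integral>\<^sup>+y. ennreal (normal_density 0 (sqrt (2 * \<delta>)) y) \<partial>lborel)
      = ennreal (\<integral>y. normal_density 0 (sqrt (2 * \<delta>)) y \<partial>lborel)"
    using \<open>0 < \<delta>\<close> by (intro nn_integral_eq_integral) auto
  also have "(\<integral>y. normal_density 0 (sqrt (2 * \<delta>)) y \<partial>lborel) = 1"
    using \<open>0 < \<delta>\<close> by simp
  finally show ?thesis
    using K by (simp add: G.emeasure_eq_measure K_def)
qed

text \<open>
  A point outside the support has a null neighbourhood, which provides the gap. Points of the
  support on either side of it give positive mass to the open half-lines bounded by \<open>z\<close>, and
  removing the null neighbourhood does not change these masses.
\<close>

lemma disconnected_support_gap:
  fixes \<mu> :: "real measure"
  assumes "real_distribution \<mu>" "\<not> connected (measure_support \<mu>)"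
  obtains z r where "0 < r" "measure \<mu> {z - r<..<z + r} = 0"
    "0 < measure \<mu> {..z - r}" "0 < measure \<mu> {z + r..}"
proof -
  interpret real_distribution \<mu> by fact
  obtain x y z where "x \<in> measure_support \<mu>" "y \<in> measure_support \<mu>" "z \<notin> measure_support \<mu>"
    "x \<le> z" "z \<le> y"
    using assms(2) unfolding connected_iff_interval by blast
  then have xy: "x \<in> measure_support \<mu>" "y \<in> measure_support \<mu>" "z \<notin> measure_support \<mu>"
    "x < z" "z < y"
    by (metis order_le_less)+
  obtain U where U: "open U" "z \<in> U" "emeasure \<mu> U = 0"
    using xy(3) unfolding measure_support_def by (auto simp: not_less)
  obtain r where r: "0 < r" "ball z r \<subseteq> U"
    using U unfolding open_contains_ball by blast
  have "emeasure \<mu> {z - r<..<z + r} \<le> emeasure \<mu> U"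
    using r U by (intro emeasure_mono) (auto simp: ball_eq_greaterThanLessThan)
  then have null: "measure \<mu> {z - r<..<z + r} = 0"
    using U by (simp add: measure_def)
  have "0 < measure \<mu> {..<z}" "0 < measure \<mu> {z<..}"
    using xy unfolding measure_support_def by (auto simp: emeasure_eq_measure)
  moreover have "measure \<mu> {..<z} \<le> measure \<mu> ({..z - r} \<union> {z - r<..<z + r})"
    using r by (intro finite_measure_mono) auto
  moreover have "measure \<mu> {z<..} \<le> measure \<mu> ({z + r..} \<union> {z - r<..<z + r})"
    using r by (intro finite_measure_mono) auto
  ultimately have "0 < measure \<mu> {..z - r}" "0 < measure \<mu> {z + r..}"
    using null measure_Un_le[of "{..z - r}" \<mu> "{z - r<..<z + r}"]
      measure_Un_le[of "{z + r..}" \<mu> "{z - r<..<z + r}"] by auto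
  with r null show thesis by (intro that)
qed

text \<open>
  Both estimates come from the event that the summand distributed as \<open>\<gamma>\<close> is smaller than
  \<open>t\<close>: on it, the sum lies within \<open>t\<close> of the summand distributed as \<open>\<mu>\<close>.
\<close>

lemma
  fixes \<mu> \<gamma> :: "real measure"
  assumes "real_distribution \<mu>" "real_distribution \<gamma>"
    and [measurable]: "A \<in> sets borel" "B \<in> sets borel"
  shows measure_convolution_le:
    "(\<And>x y. x + y \<in> A \<Longrightarrow> \<bar>y\<bar> < t \<Longrightarrow> x \<in> B) \<Longrightarrow>
      measure (convolution \<mu> \<gamma>) A \<le> measure \<mu> B + measure \<gamma> {y. t \<le> \<bar>y\<bar>}"
    and measure_convolution_ge:
    "(\<And>x y. x \<in> B \<Longrightarrow> \<bar>y\<bar> < t \<Longrightarrow> x + y \<in> A) \<Longrightarrow>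
      measure \<mu> B * (1 - measure \<gamma> {y. t \<le> \<bar>y\<bar>}) \<le> measure (convolution \<mu> \<gamma>) A"
proof -
  interpret M: real_distribution \<mu> by fact
  interpret N: real_distribution \<gamma> by fact
  interpret P: pair_prob_space \<mu> \<gamma> ..
  have T [measurable]: "{y::real. t \<le> \<bar>y\<bar>} \<in> sets borel" by measurable
  have conv: "measure (convolution \<mu> \<gamma>) A = measure (\<mu> \<Otimes>\<^sub>M \<gamma>) {(x, y). x + y \<in> A}"
    unfolding convolution_def
    by (subst measure_distr) (auto simp: space_pair_measure intro!: arg_cong2[where f = measure])
  have S: "{(x, y). x + y \<in> A} \<in> sets (\<mu> \<Otimes>\<^sub>M \<gamma>)"
  proof -
    have "(\<lambda>(x, y). x + y) -` A \<inter> space (\<mu> \<Otimes>\<^sub>M \<gamma>) \<in> sets (\<mu> \<Otimes>\<^sub>M \<gamma>)"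
      by (rule measurable_sets[where A = borel]) measurable
    then show ?thesis by (simp add: space_pair_measure vimage_def case_prod_unfold)
  qed
  have rect: "measure (\<mu> \<Otimes>\<^sub>M \<gamma>) (X \<times> Y) = measure \<mu> X * measure \<gamma> Y"
    if "X \<in> sets borel" "Y \<in> sets borel" for X Y
    using that by (simp add: N.emeasure_pair_measure_Times measure_def enn2real_mult)
  show "measure (convolution \<mu> \<gamma>) A \<le> measure \<mu> B + measure \<gamma> {y. t \<le> \<bar>y\<bar>}"
    if *: "\<And>x y. x + y \<in> A \<Longrightarrow> \<bar>y\<bar> < t \<Longrightarrow> x \<in> B"
  proof -
    have "measure (\<mu> \<Otimes>\<^sub>M \<gamma>) {(x, y). x + y \<in> A}
        \<le> measure (\<mu> \<Otimes>\<^sub>M \<gamma>) (B \<times> UNIV \<union> UNIV \<times> {y. t \<le> \<bar>y\<bar>})"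
      using * T by (intro P.finite_measure_mono sets.Un pair_measureI) (auto simp: not_le)
    also have "\<dots> \<le> measure (\<mu> \<Otimes>\<^sub>M \<gamma>) (B \<times> UNIV) + measure (\<mu> \<Otimes>\<^sub>M \<gamma>) (UNIV \<times> {y. t \<le> \<bar>y\<bar>})"
      using T by (intro measure_Un_le pair_measureI) auto
    also have "\<dots> = measure \<mu> B + measure \<gamma> {y. t \<le> \<bar>y\<bar>}"
      using M.prob_space N.prob_space T by (simp add: rect)
    finally show ?thesis unfolding conv .
  qed
  show "measure \<mu> B * (1 - measure \<gamma> {y. t \<le> \<bar>y\<bar>}) \<le> measure (convolution \<mu> \<gamma>) A"
    if *: "\<And>x y. x \<in> B \<Longrightarrow> \<bar>y\<bar> < t \<Longrightarrow> x + y \<in> A"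
  proof -
    have "1 - measure \<gamma> {y. t \<le> \<bar>y\<bar>} = measure \<gamma> (- {y. t \<le> \<bar>y\<bar>})"
      using N.prob_compl[of "{y. t \<le> \<bar>y\<bar>}"] T by (simp add: Compl_eq_Diff_UNIV)
    then have "measure \<mu> B * (1 - measure \<gamma> {y. t \<le> \<bar>y\<bar>})
        = measure (\<mu> \<Otimes>\<^sub>M \<gamma>) (B \<times> - {y. t \<le> \<bar>y\<bar>})"
      using T by (subst rect) auto
    also have "\<dots> \<le> measure (\<mu> \<Otimes>\<^sub>M \<gamma>) {(x, y). x + y \<in> A}"
      using * S by (intro P.finite_measure_mono) (auto simp: not_le[symmetric])
    finally show ?thesis unfolding conv .
  qed
qed

section \<open>Exponential growth of the log Sobolev constant\<close>

theorem theorem15: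
  fixes \<mu> :: "real measure"
  assumes "real_distribution \<mu>"
    and "compact (measure_support \<mu>)"
    and "\<not> connected (measure_support \<mu>)"
  shows "\<exists>C>0. \<forall>\<^sub>F \<delta> in at_right 0.
           log_sobolev_constant (convolution \<mu> (gaussian \<delta>)) \<ge> ereal (exp (C / \<delta>))"
proof -
  interpret real_distribution \<mu> by fact
  obtain z r where r: "0 < r" and null: "measure \<mu> {z - r<..<z + r} = 0"
    and "0 < measure \<mu> {..z - r}" "0 < measure \<mu> {z + r..}"
    using disconnected_support_gap[OF assms(1,3)] .
  define p where "p = measure \<mu> {..z - r}"
  define q where "q = measure \<mu> {z + r..}"
  have pq: "0 < p" "0 < q" by (simp_all add: p_def q_def; fact)+
  define K where "K = min (r / 2) (r\<^sup>2 / 16)"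
  have K: "0 < K" "K \<le> r / 2" "K \<le> r\<^sup>2 / 16"
    using r by (auto simp: K_def)
  define \<kappa> where "\<kappa> = p * q / 128"
  have "0 < \<kappa>" using pq by (simp add: \<kappa>_def)

  have LSI_bound: "\<kappa> * exp (K / \<delta>) - 1 \<le> c / \<delta>\<^sup>2"
    if "0 < \<delta>" and small: "sqrt 2 * exp (- K / \<delta>) \<le> 1 / 2" "exp (- K / \<delta>) < \<kappa>"
      and LSI: "LSI (convolution \<mu> (gaussian \<delta>)) c" for \<delta> c
  proof -
    let ?\<nu> = "convolution \<mu> (gaussian \<delta>)"
    interpret G: prob_space "gaussian \<delta>" by (rule prob_space_gaussian) fact
    have G: "real_distribution (gaussian \<delta>)"
      by unfold_locales (simp_all add: gaussian_def)
    interpret P: pair_prob_space \<mu> "gaussian \<delta>" ..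
    have prob: "prob_space ?\<nu>"
      unfolding convolution_def by (rule P.prob_space_distr) measurable
    define \<tau> where "\<tau> = measure (gaussian \<delta>) {y. r / 2 \<le> \<bar>y\<bar>}"
    have "\<tau> \<le> sqrt 2 * exp (- (r / 2)\<^sup>2 / (4 * \<delta>))"
      unfolding \<tau>_def using r \<open>0 < \<delta>\<close> by (intro gaussian_tail) auto
    also have "- (r / 2)\<^sup>2 / (4 * \<delta>) = - (r\<^sup>2 / 16) / \<delta>"
      by (simp add: power2_eq_square)
    also have "sqrt 2 * exp (- (r\<^sup>2 / 16) / \<delta>) \<le> sqrt 2 * exp (- K / \<delta>)"
      using divide_right_mono[OF K(3), of \<delta>] \<open>0 < \<delta>\<close> by simp
    finally have \<tau>: "\<tau> \<le> sqrt 2 * exp (- K / \<delta>)" .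
    have gap: "measure ?\<nu> {x. \<bar>x - z\<bar> < r / 2} \<le> \<tau>"
    proof -
      have "measure ?\<nu> {x. \<bar>x - z\<bar> < r / 2} \<le> measure \<mu> {z - r<..<z + r} + \<tau>"
        unfolding \<tau>_def
      proof (rule measure_convolution_le[OF assms(1) G])
        fix x y assume "x + y \<in> {x. \<bar>x - z\<bar> < r / 2}" "\<bar>y\<bar> < r / 2"
        then have "\<bar>x + y - z\<bar> < r / 2" "\<bar>y\<bar> < r / 2" by auto
        then show "x \<in> {z - r<..<z + r}" unfolding greaterThanLessThan_iff by linarith
      qed measurable
      with null show ?thesis by simp
    qed
    have "p * (1 - \<tau>) \<le> measure ?\<nu> {..z}"
      unfolding p_def \<tau>_def using r by (intro measure_convolution_ge[OF assms(1) G]) auto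
    moreover have "q * (1 - \<tau>) \<le> measure ?\<nu> {z..}"
      unfolding q_def \<tau>_def using r by (intro measure_convolution_ge[OF assms(1) G]) auto
    moreover have "p * (1 / 2) \<le> p * (1 - \<tau>)" "q * (1 / 2) \<le> q * (1 - \<tau>)"
      using \<tau> small pq by (intro mult_left_mono; linarith)+
    ultimately have sides: "p / 2 \<le> measure ?\<nu> {..z}" "q / 2 \<le> measure ?\<nu> {z..}"
      by linarith+
    \<comment> \<open>The gap of radius \<open>r\<close> is shared equally: the Gaussian part may move mass by \<open>r/2\<close>, and the
      remaining \<open>r/2\<close> is room for the logistic function to flatten.\<close>
    define w where "w = exp (- (1 / \<delta> * (r / 2))) + \<tau>"
    define I where "I = (\<integral>x. \<bar>deriv (logistic (1 / \<delta>) z) x\<bar>\<^sup>2 \<partial>?\<nu>)"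
    have main: "3 / 16 * (p / 2 * (q / 2)) - 2 * w \<le> 2 * c * I" "I \<le> (1 / \<delta>)\<^sup>2 * w"
      using LSI_two_lumps[OF prob _ LSI _ _ gap sides, of "1 / \<delta>"] r \<open>0 < \<delta>\<close> pq
      unfolding w_def I_def by auto
    have "exp (- (1 / \<delta> * (r / 2))) \<le> exp (- K / \<delta>)"
      using K \<open>0 < \<delta>\<close> by (simp add: field_simps)
    moreover have "sqrt 2 * exp (- K / \<delta>) \<le> 2 * exp (- K / \<delta>)"
      by (intro mult_right_mono) (auto simp: real_sqrt_le_iff[of 2 4, simplified])
    ultimately have w: "w \<le> 3 * exp (- K / \<delta>)"
      using \<tau> unfolding w_def by linarith
    have \<kappa>: "3 / 16 * (p / 2 * (q / 2)) = 6 * \<kappa>"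
      by (simp add: \<kappa>_def)
    have "0 \<le> I" unfolding I_def by simp
    \<comment> \<open>Multiplying the energy bound by \<open>c\<close> requires its sign.\<close>
    have "0 < 2 * c * I"
      using main(1) w small(2) unfolding \<kappa> by linarith
    then have "0 < c"
      using \<open>0 \<le> I\<close> by (simp add: zero_less_mult_iff)
    then have "2 * c * I \<le> 2 * c * ((1 / \<delta>)\<^sup>2 * w)"
      using main(2) by (intro mult_left_mono) auto
    then have "6 * \<kappa> \<le> 2 * (w * (1 + c / \<delta>\<^sup>2))"
      using main(1) unfolding \<kappa> by (simp add: field_simps power2_eq_square)
    also have "\<dots> \<le> 2 * (3 * exp (- K / \<delta>) * (1 + c / \<delta>\<^sup>2))"
      using w \<open>0 < c\<close> by (intro mult_left_mono mult_right_mono) auto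
    finally have "\<kappa> \<le> exp (- K / \<delta>) * (1 + c / \<delta>\<^sup>2)"
      by simp
    then have "\<kappa> * exp (K / \<delta>) \<le> exp (- K / \<delta>) * (1 + c / \<delta>\<^sup>2) * exp (K / \<delta>)"
      by (intro mult_right_mono) auto
    also have "\<dots> = (exp (- K / \<delta>) * exp (K / \<delta>)) * (1 + c / \<delta>\<^sup>2)"
      by (simp only: mult_ac)
    also have "exp (- K / \<delta>) * exp (K / \<delta>) = 1"
      by (simp add: exp_minus)
    finally show ?thesis by simp
  qed

  have "\<forall>\<^sub>F \<delta> in at_right 0. sqrt 2 * exp (- K / \<delta>) \<le> 1 / 2"
    using \<open>0 < K\<close> by real_asymp
  moreover have "\<forall>\<^sub>F \<delta> in at_right 0. exp (- K / \<delta>) < \<kappa>"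
    using \<open>0 < K\<close> \<open>0 < \<kappa>\<close> by real_asymp
  moreover have "\<forall>\<^sub>F \<delta> in at_right 0. exp (K / 2 / \<delta>) \<le> \<delta>\<^sup>2 * (\<kappa> * exp (K / \<delta>) - 1)"
    using \<open>0 < K\<close> \<open>0 < \<kappa>\<close> by real_asymp
  moreover have "\<forall>\<^sub>F \<delta> in at_right (0::real). 0 < \<delta>"
    by (rule eventually_at_right_less)
  ultimately have "\<forall>\<^sub>F \<delta> in at_right 0.
      ereal (exp (K / 2 / \<delta>)) \<le> log_sobolev_constant (convolution \<mu> (gaussian \<delta>))"
  proof eventually_elim
    case (elim \<delta>)
    have "exp (K / 2 / \<delta>) \<le> c" if "LSI (convolution \<mu> (gaussian \<delta>)) c" for c
    proof -
      have "\<delta>\<^sup>2 * (\<kappa> * exp (K / \<delta>) - 1) \<le> c"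
        using LSI_bound[OF elim(4,1,2) that] elim(4) by (simp add: field_simps)
      with elim(3) show ?thesis by linarith
    qed
    then show ?case
      unfolding log_sobolev_constant_def by (intro Inf_greatest) auto
  qed
  then show ?thesis
    using \<open>0 < K\<close> by (intro exI[of _ "K / 2"]) auto
qed

end
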